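(* Let $f_d:\mathbb D\to\mathbb D^2$ be the complex geodesic $f_d(\lambda)=(\lambda,\lambda)$, $\lambda\in\mathbb D$. Any Lempert left inverse $G:\mathbb D^2\to\mathbb D$ to $f_d$ is of the following form: there is $t\in[0,1]$ such that $G(z)=tz_1+(1-t)z_2$ for all $z=(z_1,z_2)\in\mathbb D^2$.
   Context: $\mathbb D$ is the open unit disc in $\mathbb C$. A left inverse to a holomorphic map $f:\mathbb D\to D$ ($D\subset\mathbb C^n$ a domain) is a holomorphic function $G:D\to\mathbb D$ with $G(f(\lambda))=\lambda$ for all $\lambda\in\mathbb D$; $f$ is a complex geodesic if it has a left inverse. A left inverse $G$ is called a Lempert left inverse if for every $\lambda\in\mathbb D$ the fiber $G^{-1}(\lambda)$ is the intersection of $D$ with a complex affine hyperplane of $\mathbb C^n$ (a complex affine line when $n=2$). *)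

theory Defs
  imports "HOL-Analysis.Analysis"
begin

text \<open>
  Holomorphy of a scalar function of several variables on an open set: at every point there is a
  Frechet derivative which is complex linear, i.e. of the form
  \<open>h \<mapsto> a\<^sub>1 h\<^sub>1 + \<dots> + a\<^sub>n h\<^sub>n\<close>. The full \<open>at z\<close> filter is used, so this is meant for open \<open>S\<close> only.
\<close>

definition holomorphic_Cn :: "(complex ^ 'n \<Rightarrow> complex) \<Rightarrow> (complex ^ 'n) set \<Rightarrow> bool" where
  "holomorphic_Cn G S \<longleftrightarrow>
     (\<forall>z\<in>S. \<exists>a :: complex ^ 'n. (G has_derivative (\<lambda>h. \<Sum>i\<in>UNIV. a $ i * h $ i)) (at z))"

abbreviation unit_disc :: "complex set" where
  "unit_disc \<equiv> ball 0 1"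

definition holomorphic_disc :: "(complex \<Rightarrow> complex ^ 'n) \<Rightarrow> (complex ^ 'n) set \<Rightarrow> bool" where
  "holomorphic_disc f D \<longleftrightarrow>
     (\<forall>i. (\<lambda>w. f w $ i) holomorphic_on unit_disc) \<and> f ` unit_disc \<subseteq> D"

text \<open>In the following definitions \<open>D\<close> is meant to be a domain in \<open>\<complex>\<^sup>n\<close>.
  All functions are total; their values outside \<open>unit_disc\<close> and \<open>D\<close> are irrelevant.\<close>

definition left_inverse ::
    "(complex ^ 'n) set \<Rightarrow> (complex \<Rightarrow> complex ^ 'n) \<Rightarrow> (complex ^ 'n \<Rightarrow> complex) \<Rightarrow> bool" where
  "left_inverse D f G \<longleftrightarrow>
     holomorphic_disc f D \<and> holomorphic_Cn G D \<and> G ` D \<subseteq> unit_disc \<and>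
     (\<forall>w\<in>unit_disc. G (f w) = w)"

definition complex_geodesic :: "(complex ^ 'n) set \<Rightarrow> (complex \<Rightarrow> complex ^ 'n) \<Rightarrow> bool" where
  "complex_geodesic D f \<longleftrightarrow> (\<exists>G. left_inverse D f G)"

definition complex_hyperplane :: "(complex ^ 'n) set \<Rightarrow> bool" where
  "complex_hyperplane H \<longleftrightarrow>
     (\<exists>(a :: complex ^ 'n) b. a \<noteq> 0 \<and> H = {z. (\<Sum>i\<in>UNIV. a $ i * z $ i) = b})"

definition Lempert_left_inverse ::
    "(complex ^ 'n) set \<Rightarrow> (complex \<Rightarrow> complex ^ 'n) \<Rightarrow> (complex ^ 'n \<Rightarrow> complex) \<Rightarrow> bool" where
  "Lempert_left_inverse D f G \<longleftrightarrow>
     left_inverse D f G \<and>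
     (\<forall>w\<in>unit_disc. \<exists>H. complex_hyperplane H \<and> {z \<in> D. G z = w} = D \<inter> H)"

definition bidisc :: "(complex ^ 2) set" where
  "bidisc = {z. z $ 1 \<in> unit_disc \<and> z $ 2 \<in> unit_disc}"

definition f_d :: "complex \<Rightarrow> complex ^ 2" where
  "f_d w = vector [w, w]"

lemma complex_geodesic_f_d: "complex_geodesic bidisc f_d"
proof -
  have "((\<lambda>z. z $ 1) has_derivative (\<lambda>h. \<Sum>i\<in>UNIV. axis 1 1 $ i * h $ i)) (at z)"
    for z :: "complex ^ 2"
  proof -
    have "((\<lambda>z. z $ 1) has_derivative (\<lambda>h. h $ 1)) (at z)"
      by (rule bounded_linear_imp_has_derivative[OF bounded_linear_vec_nth])
    then show ?thesis by (simp add: sum_2 axis_def)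
  qed
  then have "holomorphic_Cn (\<lambda>z. z $ 1) bidisc"
    unfolding holomorphic_Cn_def by blast
  moreover have "holomorphic_disc f_d bidisc"
    by (auto simp: holomorphic_disc_def f_d_def bidisc_def forall_2)
  ultimately have "left_inverse bidisc f_d (\<lambda>z. z $ 1)"
    by (auto simp: left_inverse_def f_d_def bidisc_def)
  then show ?thesis
    unfolding complex_geodesic_def by blast
qed

end

theory Submission
  imports Defs "HOL-Complex_Analysis.Riemann_Mapping"
begin

text \<open>
  Off the diagonal consider the quotient \<open>(G z - z\<^sub>2) / (z\<^sub>1 - z\<^sub>2)\<close>. It equals \<open>t\<close> exactly when
  \<open>G z = t z\<^sub>1 + (1 - t) z\<^sub>2\<close>, so the task is to show that it is a constant in \<open>[0, 1]\<close>.

  Let \<open>w = G z\<close>. Both \<open>z\<close> and \<open>f_d w = (w, w)\<close> lie in the fibre over \<open>w\<close>, hence so does the part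
  inside the bidisc of the complex line joining them. Therefore the derivative of \<open>G\<close> at \<open>(w, w)\<close>,
  say \<open>h \<mapsto> a\<^sub>1 h\<^sub>1 + a\<^sub>2 h\<^sub>2\<close>, kills \<open>z - (w, w)\<close>. Since \<open>a\<^sub>1 + a\<^sub>2 = 1\<close> (differentiate
  \<open>G (v, v) = v\<close>), this says that the quotient at \<open>z\<close> is \<open>a\<^sub>1\<close>. The Schwarz-Pick inequality on the
  bidisc gives \<open>\<bar>a\<^sub>1\<bar> + \<bar>a\<^sub>2\<bar> \<le> 1\<close>, and together with \<open>a\<^sub>1 + a\<^sub>2 = 1\<close> this forces \<open>a\<^sub>1 \<in> [0, 1]\<close>
  (\<open>Lempert_left_inverse_quotient_real\<close>).

  The quotient is holomorphic in each variable on a punctured disc, which is connected. Being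
  real-valued there, it is constant in each variable separately by the open mapping theorem, and
  any two off-diagonal points are joined by moves that change one coordinate at a time
  (\<open>Lempert_left_inverse_quotient_constant\<close>). On the diagonal the formula is the left inverse
  property.
\<close>

section \<open>Restriction to holomorphic curves\<close>

lemma has_derivative_vecI:
  fixes p :: "'a::real_normed_vector \<Rightarrow> 'b::euclidean_space ^ 'n"
  assumes "\<And>i. ((\<lambda>x. p x $ i) has_derivative (\<lambda>h. p' h $ i)) (at x within S)"
  shows "(p has_derivative p') (at x within S)"
  using assms
  by (subst has_derivative_componentwise_within)
     (auto simp: Basis_vec_def inner_axis intro!: has_derivative_inner_left)

lemma has_field_derivative_along_curve:
  fixes p :: "complex \<Rightarrow> complex ^ 'n"
  assumes G: "(G has_derivative (\<lambda>h. \<Sum>i\<in>UNIV. a $ i * h $ i)) (at (p w))"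
    and p: "\<And>i. ((\<lambda>w. p w $ i) has_field_derivative d i) (at w)"
  shows "((\<lambda>w. G (p w)) has_field_derivative (\<Sum>i\<in>UNIV. a $ i * d i)) (at w)"
proof -
  have "(p has_derivative (\<lambda>h. \<chi> i. d i * h)) (at w)"
    by (rule has_derivative_vecI) (use p in \<open>simp add: has_field_derivative_def\<close>)
  from has_derivative_compose[OF this G]
  have "((\<lambda>w. G (p w)) has_derivative (\<lambda>h. \<Sum>i\<in>UNIV. a $ i * (d i * h))) (at w)"
    by simp
  moreover have "(\<lambda>h. \<Sum>i\<in>UNIV. a $ i * (d i * h)) = (*) (\<Sum>i\<in>UNIV. a $ i * d i)"
    by (simp add: fun_eq_iff sum_distrib_right mult.assoc)
  ultimately show ?thesis
    by (simp add: has_field_derivative_def)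
qed

lemma holomorphic_on_along_curve:
  fixes p :: "complex \<Rightarrow> complex ^ 'n"
  assumes G: "holomorphic_Cn G D" and S: "open S" "p ` S \<subseteq> D"
    and p: "\<And>i. (\<lambda>w. p w $ i) holomorphic_on S"
  shows "(\<lambda>w. G (p w)) holomorphic_on S"
proof -
  have "(\<lambda>w. G (p w)) field_differentiable (at w)" if w: "w \<in> S" for w
  proof -
    obtain a where "(G has_derivative (\<lambda>h. \<Sum>i\<in>UNIV. a $ i * h $ i)) (at (p w))"
      using G S w unfolding holomorphic_Cn_def by blast
    from has_field_derivative_along_curve[OF this holomorphic_derivI[OF p \<open>open S\<close> w]]
    show ?thesis
      unfolding field_differentiable_def by blast
  qed
  then show ?thesis
    using S(1) by (simp add: holomorphic_on_open field_differentiable_def)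
qed

text \<open>The form in which the coordinates of the slices \<open>x \<mapsto> (x, b)\<close> and \<open>y \<mapsto> (b, y)\<close> are seen to be
  holomorphic.\<close>

lemma holomorphic_on_vector_2:
  assumes "f holomorphic_on S" "g holomorphic_on S"
  shows "(\<lambda>x. (vector [f x, g x] :: complex ^ 2) $ i) holomorphic_on S"
  using assms exhaust_2[of i] by auto

section \<open>The Schwarz-Pick inequality on the bidisc\<close>

lemma Moebius_function_has_field_derivative:
  assumes "1 - cnj w * z \<noteq> 0"
  shows "(Moebius_function 0 w has_field_derivative
           (1 - (cmod w)\<^sup>2) / (1 - cnj w * z)\<^sup>2) (at z)"
proof -
  have norm_w: "complex_of_real (cmod w) * complex_of_real (cmod w) = w * cnj w"
    using complex_norm_square[of w] by (simp add: power2_eq_square)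
  have "((\<lambda>z. (z - w) / (1 - cnj w * z)) has_field_derivative
           (1 - (cmod w)\<^sup>2) / (1 - cnj w * z)\<^sup>2) (at z)"
    by (rule derivative_eq_intros refl assms)+
       (simp add: assms norm_w power2_eq_square algebra_simps)
  then show ?thesis
    by (simp add: Moebius_function_simple[abs_def])
qed

lemma unimodular_rotation:
  obtains u where "cmod u = 1" "u * a = complex_of_real (cmod a)"
proof (cases "a = 0")
  case True
  then show thesis using that[of 1] by simp
next
  case False
  have "cnj a * a = complex_of_real (cmod a) * complex_of_real (cmod a)"
    using complex_norm_square[of a] by (simp add: power2_eq_square mult.commute)
  then show thesis
    using False that[of "cnj a / cmod a"] by (simp add: norm_divide)
qed

text \<open>
  Pull \<open>G\<close> back to the disc along \<open>\<zeta> \<mapsto> (m\<^sub>1 (u\<^sub>1 \<zeta>), m\<^sub>2 (u\<^sub>2 \<zeta>))\<close>, where \<open>m\<^sub>i\<close> is the disc automorphism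
  with \<open>m\<^sub>i 0 = z\<^sub>i\<close> and \<open>u\<^sub>1\<close>, \<open>u\<^sub>2\<close> are unimodular, and move \<open>G z\<close> back to \<open>0\<close> by another
  automorphism. The result is a self-map of the disc fixing \<open>0\<close>, so its derivative at \<open>0\<close> has modulus
  at most \<open>1\<close> by the Schwarz lemma. With \<open>u\<^sub>i\<close> chosen so that \<open>u\<^sub>i a\<^sub>i = \<bar>a\<^sub>i\<bar>\<close>, that derivative is
  the quotient of the two sides below.
\<close>

lemma Schwarz_Pick_bidisc:
  fixes G :: "complex ^ 2 \<Rightarrow> complex"
  assumes G: "holomorphic_Cn G bidisc" and Gdisc: "G ` bidisc \<subseteq> unit_disc"
    and z: "z \<in> bidisc"
    and dG: "(G has_derivative (\<lambda>h. \<Sum>i\<in>UNIV. a $ i * h $ i)) (at z)"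
  shows "cmod (a $ 1) * (1 - (cmod (z $ 1))\<^sup>2) + cmod (a $ 2) * (1 - (cmod (z $ 2))\<^sup>2)
           \<le> 1 - (cmod (G z))\<^sup>2"
proof -
  define r where "r i = 1 - (cmod (z $ i))\<^sup>2" for i
  define s where "s = 1 - (cmod (G z))\<^sup>2"
  have z1: "cmod (z $ i) < 1" for i
    using z exhaust_2[of i] by (auto simp: bidisc_def)
  have Gz1: "cmod (G z) < 1"
    using z Gdisc by auto
  have s: "0 < s"
    using Gz1 by (simp add: s_def power_less_one_iff)
  have "\<exists>u. cmod u = 1 \<and> u * a $ i = cmod (a $ i)" for i
    using unimodular_rotation by metis
  then obtain u where u: "\<And>i. cmod (u i) = 1" "\<And>i. u i * a $ i = cmod (a $ i)"
    by metis
  \<comment> \<open>\<open>Moebius_function 0 v\<close> sends \<open>v\<close> to \<open>0\<close>, so the parameter \<open>- z $ i\<close> yields the automorphism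
    sending \<open>0\<close> to \<open>z $ i\<close>.\<close>
  define p :: "complex \<Rightarrow> complex ^ 2"
    where "p \<zeta> = (\<chi> i. Moebius_function 0 (- z $ i) (u i * \<zeta>))" for \<zeta>
  have p0: "p 0 = z"
    by (simp add: p_def Moebius_function_of_zero)
  have p_bidisc: "p \<zeta> \<in> bidisc" if "cmod \<zeta> < 1" for \<zeta>
    using that z1 u by (auto simp: p_def bidisc_def norm_mult intro!: Moebius_function_norm_lt_1)
  have p_hol: "(\<lambda>\<zeta>. p \<zeta> $ i) holomorphic_on unit_disc" for i
  proof -
    have "(Moebius_function 0 (- z $ i) \<circ> (\<lambda>\<zeta>. u i * \<zeta>)) holomorphic_on unit_disc"
      using z1 u
      by (intro holomorphic_on_compose_gen[of _ _ _ "ball 0 1"] Moebius_function_holomorphic)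
         (auto intro!: holomorphic_intros simp: norm_mult)
    then show ?thesis
      by (simp add: p_def o_def)
  qed
  have p_deriv: "((\<lambda>\<zeta>. p \<zeta> $ i) has_field_derivative r i * u i) (at 0)" for i
  proof -
    have "(Moebius_function 0 (- z $ i) has_field_derivative r i) (at (u i * 0))"
      using Moebius_function_has_field_derivative[of "- z $ i" 0] by (simp add: r_def)
    moreover have "((\<lambda>\<zeta>. u i * \<zeta>) has_field_derivative u i) (at 0)"
      by (auto intro!: derivative_eq_intros)
    ultimately show ?thesis
      unfolding p_def vec_lambda_beta by (rule DERIV_chain2)
  qed
  define \<phi> where "\<phi> \<zeta> = Moebius_function 0 (G z) (G (p \<zeta>))" for \<zeta>
  have Gp: "cmod (G (p \<zeta>)) < 1" if "cmod \<zeta> < 1" for \<zeta>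
    using p_bidisc[OF that] Gdisc by auto
  have "(Moebius_function 0 (G z) \<circ> (\<lambda>\<zeta>. G (p \<zeta>))) holomorphic_on unit_disc"
    using Gz1 Gp
    by (intro holomorphic_on_compose_gen[of _ _ _ "ball 0 1"] Moebius_function_holomorphic
          holomorphic_on_along_curve[OF G _ _ p_hol])
       (auto simp: p_bidisc)
  then have \<phi>_hol: "\<phi> holomorphic_on unit_disc"
    by (simp add: \<phi>_def[abs_def] o_def)
  have "\<phi> 0 = 0"
    by (simp add: \<phi>_def p0 Moebius_function_eq_zero)
  then have le: "cmod (deriv \<phi> 0) \<le> 1"
    by (intro Schwarz_Lemma(2)[OF \<phi>_hol, of 0])
       (auto simp: \<phi>_def Gp Gz1 intro!: Moebius_function_norm_lt_1)
  have "(Moebius_function 0 (G z) has_field_derivative 1 / s) (at (G (p 0)))"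
  proof -
    have "1 - cnj (G z) * G z = complex_of_real s"
      using complex_norm_square[of "G z"] by (simp add: s_def mult.commute)
    moreover have "complex_of_real s / (complex_of_real s)\<^sup>2 = 1 / s"
      using s by (simp add: power2_eq_square)
    ultimately show ?thesis
      using Moebius_function_has_field_derivative[of "G z" "G z"] s
      by (simp add: p0 flip: s_def)
  qed
  moreover have "((\<lambda>\<zeta>. G (p \<zeta>)) has_field_derivative (\<Sum>i\<in>UNIV. a $ i * (r i * u i))) (at 0)"
    using dG p_deriv by (intro has_field_derivative_along_curve) (simp_all add: p0)
  ultimately have "(\<phi> has_field_derivative 1 / s * (\<Sum>i\<in>UNIV. a $ i * (r i * u i))) (at 0)"
    unfolding \<phi>_def by (rule DERIV_chain2)
  then have "deriv \<phi> 0 = 1 / s * (\<Sum>i\<in>UNIV. r i * (u i * a $ i))"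
    by (simp add: DERIV_imp_deriv mult_ac)
  also have "\<dots> = of_real ((cmod (a $ 1) * r 1 + cmod (a $ 2) * r 2) / s)"
    by (simp add: u sum_2 mult.commute)
  finally have "\<bar>(cmod (a $ 1) * r 1 + cmod (a $ 2) * r 2) / s\<bar> \<le> 1"
    using le by (simp only: norm_of_real)
  then show ?thesis
    using s by (simp add: r_def s_def field_simps abs_le_iff)
qed

section \<open>Real-valued holomorphic functions\<close>

text \<open>A nonconstant \<open>f\<close> would have an open image, but no set of real numbers contains a disc.\<close>

lemma holomorphic_real_valued_imp_constant_on:
  assumes "f holomorphic_on S" "open S" "connected S" "f ` S \<subseteq> \<real>"
  shows "f constant_on S"
proof (rule ccontr)
  assume nc: "\<not> f constant_on S"
  then have "open (f ` S)"
    using assms by (intro open_mapping_thm[of f S S]) auto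
  moreover obtain x where x: "x \<in> S"
    using nc unfolding constant_on_def by blast
  ultimately obtain e where e: "e > 0" "ball (f x) e \<subseteq> f ` S"
    by (meson imageI open_contains_ball)
  have "f x + \<i> * of_real (e / 2) \<in> ball (f x) e"
    using e by (simp add: dist_norm norm_mult)
  then have "f x + \<i> * of_real (e / 2) \<in> \<real>"
    using e assms by blast
  moreover have "f x \<in> \<real>"
    using x assms by blast
  ultimately show False
    using e by (auto simp: complex_is_Real_iff)
qed

section \<open>Lempert left inverses of the diagonal\<close>

text \<open>The fibre over \<open>G z\<close> contains \<open>z\<close> and \<open>f (G z)\<close>, and a complex hyperplane contains with two
  points the whole complex line through them.\<close>

lemma Lempert_left_inverse_constant_on_line:
  assumes G: "Lempert_left_inverse D f G" and "z \<in> D" "G z \<in> unit_disc"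
    and on_line: "f (G z) + t *s (z - f (G z)) \<in> D"
  shows "G (f (G z) + t *s (z - f (G z))) = G z"
proof -
  let ?w = "G z"
  obtain H where H: "complex_hyperplane H" "{z \<in> D. G z = ?w} = D \<inter> H"
    using assms unfolding Lempert_left_inverse_def by blast
  then obtain a b where ab: "H = {z. (\<Sum>i\<in>UNIV. a $ i * z $ i) = b}"
    unfolding complex_hyperplane_def by blast
  have fw: "f ?w \<in> D" "G (f ?w) = ?w"
    using assms unfolding Lempert_left_inverse_def left_inverse_def holomorphic_disc_def by auto
  have z: "(\<Sum>i\<in>UNIV. a $ i * z $ i) = b" "(\<Sum>i\<in>UNIV. a $ i * f ?w $ i) = b"
    using H ab fw \<open>z \<in> D\<close> by blast+
  have "(\<Sum>i\<in>UNIV. a $ i * (f ?w + t *s (z - f ?w)) $ i)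
      = (\<Sum>i\<in>UNIV. a $ i * f ?w $ i)
        + t * ((\<Sum>i\<in>UNIV. a $ i * z $ i) - (\<Sum>i\<in>UNIV. a $ i * f ?w $ i))"
    by (simp add: sum_distrib_left sum.distrib sum_subtractf algebra_simps)
  then have "f ?w + t *s (z - f ?w) \<in> H"
    using z ab by simp
  then show ?thesis
    using H(2) on_line by blast
qed

text \<open>The quotient at \<open>z\<close> is the first partial derivative of \<open>G\<close> at the diagonal point of the fibre
  through \<open>z\<close>, and the Schwarz-Pick inequality at that point, where the three factors
  \<open>1 - \<bar>w\<bar>\<^sup>2\<close> agree, puts this derivative into \<open>[0, 1]\<close>.\<close>

lemma Lempert_left_inverse_quotient_real:
  assumes G: "Lempert_left_inverse bidisc f_d G" and z: "z \<in> bidisc" "z $ 1 \<noteq> z $ 2"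
  obtains t where "0 \<le> t" "t \<le> 1" "(G z - z $ 2) / (z $ 1 - z $ 2) = complex_of_real t"
proof -
  define w where "w = G z"
  have li: "left_inverse bidisc f_d G"
    using G by (simp add: Lempert_left_inverse_def)
  have w: "cmod w < 1"
    using li z by (auto simp: left_inverse_def w_def)
  then have fw: "f_d w \<in> bidisc"
    by (auto simp: f_d_def bidisc_def)
  have Gf: "G (f_d v) = v" if "cmod v < 1" for v
    using li that by (auto simp: left_inverse_def)
  obtain a where a: "(G has_derivative (\<lambda>h. \<Sum>i\<in>UNIV. a $ i * h $ i)) (at (f_d w))"
    using li fw unfolding left_inverse_def holomorphic_Cn_def by blast
  have "((\<lambda>v. G (f_d v)) has_field_derivative (\<Sum>i\<in>UNIV. a $ i * 1)) (at w)"
  proof (rule has_field_derivative_along_curve[where p = f_d, OF a])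
    show "((\<lambda>v. f_d v $ i) has_field_derivative 1) (at w)" for i
      using exhaust_2[of i] by (auto simp: f_d_def)
  qed
  moreover have "((\<lambda>v. G (f_d v)) has_field_derivative 1) (at w)"
    by (rule has_field_derivative_transform_within_open[OF DERIV_ident, of "ball 0 1"])
       (use w Gf in auto)
  ultimately have sum1: "a $ 1 + a $ 2 = 1"
    using DERIV_unique by (fastforce simp: sum_2)
  have "(cmod (a $ 1) + cmod (a $ 2)) * (1 - (cmod w)\<^sup>2) \<le> 1 * (1 - (cmod w)\<^sup>2)"
    using Schwarz_Pick_bidisc[OF _ _ fw a] li Gf[OF w]
    by (simp add: left_inverse_def f_d_def algebra_simps)
  moreover have "0 < 1 - (cmod w)\<^sup>2"
    using w by (simp add: power_less_one_iff)
  ultimately have norm1: "cmod (a $ 1) + cmod (a $ 2) \<le> 1"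
    by (simp only: mult_le_cancel_right_pos)
  \<comment> \<open>Equality holds in \<open>1 = Re a\<^sub>1 + Re a\<^sub>2 \<le> \<bar>a\<^sub>1\<bar> + \<bar>a\<^sub>2\<bar> \<le> 1\<close>, so \<open>a\<^sub>1\<close> is its own modulus.\<close>
  have "Re (a $ 1) + Re (a $ 2) = 1"
    using sum1 by (metis one_complex.sel(1) plus_complex.sel(1))
  with norm1 complex_Re_le_cmod[of "a $ 1"] complex_Re_le_cmod[of "a $ 2"]
  have re: "Re (a $ 1) = cmod (a $ 1)" "Re (a $ 1) \<le> 1"
    using norm_ge_zero[of "a $ 2"] by linarith+
  then have "Im (a $ 1) = 0"
    using cmod_power2[of "a $ 1"] by simp
  then have a1: "a $ 1 = of_real (Re (a $ 1))" "0 \<le> Re (a $ 1)"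
    using re(1) by (simp_all add: complex_eq_iff)
  \<comment> \<open>The complex line from the diagonal point \<open>(w, w)\<close> to \<open>z\<close>; it stays in the bidisc for parameters
    near \<open>0\<close>, which is enough to differentiate \<open>G = w\<close> along it.\<close>
  let ?c = "\<lambda>v. f_d w + v *s (z - f_d w)"
  define V where "V = {v. ?c v \<in> bidisc}"
  have "V = {v. cmod (w + v * (z $ 1 - w)) < 1} \<inter> {v. cmod (w + v * (z $ 2 - w)) < 1}"
    by (auto simp: V_def bidisc_def f_d_def right_diff_distrib)
  then have V: "open V" "0 \<in> V"
    using w by (auto intro!: open_Int open_Collect_less continuous_intros)
  have "((\<lambda>v. G (?c v)) has_field_derivative 0) (at 0)"
  proof (rule has_field_derivative_transform_within_open[OF DERIV_const V])
    show "w = G (?c v)" if "v \<in> V" for v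
      using Lempert_left_inverse_constant_on_line[OF G z(1), of v] that w
      by (simp add: V_def w_def)
  qed
  moreover have "((\<lambda>v. G (?c v)) has_field_derivative (\<Sum>i\<in>UNIV. a $ i * (z - f_d w) $ i)) (at 0)"
    by (rule has_field_derivative_along_curve) (use a in \<open>auto intro!: derivative_eq_intros\<close>)
  ultimately have "(\<Sum>i\<in>UNIV. a $ i * (z - f_d w) $ i) = 0"
    using DERIV_unique by blast
  then have "a $ 1 * (z $ 1 - w) + a $ 2 * (z $ 2 - w) = 0"
    by (simp add: sum_2 f_d_def)
  moreover have "a $ 2 = 1 - a $ 1"
    using sum1 by (simp add: algebra_simps)
  ultimately have "w - z $ 2 = a $ 1 * (z $ 1 - z $ 2)"
    by (simp add: algebra_simps)
  then have "(G z - z $ 2) / (z $ 1 - z $ 2) = a $ 1"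
    using z(2) by (simp add: w_def)
  then show thesis
    using that a1 re by metis
qed

text \<open>On each horizontal or vertical slice the quotient is a real-valued holomorphic function on a
  punctured disc, hence constant.\<close>

lemma Lempert_left_inverse_quotient_constant:
  assumes G: "Lempert_left_inverse bidisc f_d G"
  obtains k where "\<And>z. z \<in> bidisc \<Longrightarrow> z $ 1 \<noteq> z $ 2 \<Longrightarrow> (G z - z $ 2) / (z $ 1 - z $ 2) = k"
proof -
  define q :: "complex \<Rightarrow> complex \<Rightarrow> complex" where "q x y = (G (vector [x, y]) - y) / (x - y)" for x y
  have hol: "holomorphic_Cn G bidisc"
    using G by (simp add: Lempert_left_inverse_def left_inverse_def)
  have real: "q x y \<in> \<real>" if "x \<in> unit_disc" "y \<in> unit_disc" "x \<noteq> y" for x y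
    using Lempert_left_inverse_quotient_real[OF G, of "vector [x, y]"] that
    by (metis (no_types, lifting) Reals_of_real bidisc_def mem_Collect_eq q_def vector_2)
  have conn: "connected (unit_disc - {b})" for b :: complex
    by (intro connected_punctured_convex) (simp_all add: aff_dim_open)
  have fst: "q x b = q x' b"
    if "x \<in> unit_disc - {b}" "x' \<in> unit_disc - {b}" "b \<in> unit_disc" for x x' b
  proof -
    have "(\<lambda>x. G (vector [x, b])) holomorphic_on (unit_disc - {b})"
      using that by (intro holomorphic_on_along_curve[OF hol])
        (auto simp: bidisc_def intro!: holomorphic_on_vector_2 holomorphic_intros)
    then have "(\<lambda>x. q x b) constant_on (unit_disc - {b})"
      using conn that unfolding q_def
      by (intro holomorphic_real_valued_imp_constant_on)
         (auto intro!: holomorphic_intros real[unfolded q_def])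
    then show ?thesis
      using that unfolding constant_on_def by metis
  qed
  have snd: "q b y = q b y'"
    if "y \<in> unit_disc - {b}" "y' \<in> unit_disc - {b}" "b \<in> unit_disc" for y y' b
  proof -
    have "(\<lambda>y. G (vector [b, y])) holomorphic_on (unit_disc - {b})"
      using that by (intro holomorphic_on_along_curve[OF hol])
        (auto simp: bidisc_def intro!: holomorphic_on_vector_2 holomorphic_intros)
    then have "(\<lambda>y. q b y) constant_on (unit_disc - {b})"
      using conn that unfolding q_def
      by (intro holomorphic_real_valued_imp_constant_on)
         (auto intro!: holomorphic_intros real[unfolded q_def])
    then show ?thesis
      using that unfolding constant_on_def by metis
  qed
  have eq: "q x y = q x' y'"
    if "x \<in> unit_disc" "y \<in> unit_disc" "x \<noteq> y" "x' \<in> unit_disc" "y' \<in> unit_disc" "x' \<noteq> y'"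
    for x y x' y'
  proof -
    \<comment> \<open>The route \<open>(x, y) \<rightarrow> (e, y) \<rightarrow> (e, y') \<rightarrow> (x', y')\<close> avoids the diagonal as \<open>e \<noteq> y\<close> and \<open>e \<noteq> y'\<close>.\<close>
    have "infinite (ball (0::complex) 1)"
      by (simp add: uncountable_ball uncountable_infinite)
    then have "infinite (unit_disc - {y, y'})"
      by simp
    then have "unit_disc - {y, y'} \<noteq> {}"
      by (metis finite.emptyI)
    then obtain e where e: "e \<in> unit_disc" "e \<noteq> y" "e \<noteq> y'"
      by blast
    have "q x y = q e y"
      using that e by (intro fst) auto
    also have "\<dots> = q e y'"
      using that e by (intro snd) auto
    also have "\<dots> = q x' y'"
      using that e by (intro fst) auto
    finally show ?thesis .
  qed
  have "q x y = q (1/2) 0" if "x \<in> unit_disc" "y \<in> unit_disc" "x \<noteq> y" for x y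
    by (rule eq) (use that in simp_all)
  moreover have "(G z - z $ 2) / (z $ 1 - z $ 2) = q (z $ 1) (z $ 2)" for z
  proof -
    have "vector [z $ 1, z $ 2] = z"
      by (simp add: vec_eq_iff forall_2)
    then show ?thesis
      by (simp add: q_def)
  qed
  ultimately have "(G z - z $ 2) / (z $ 1 - z $ 2) = q (1/2) 0"
    if "z \<in> bidisc" "z $ 1 \<noteq> z $ 2" for z
    using that unfolding bidisc_def by (metis (mono_tags, lifting) mem_Collect_eq)
  then show thesis
    by (rule that)
qed

theorem proposition4p1:
  fixes G :: "complex ^ 2 \<Rightarrow> complex"
  assumes "Lempert_left_inverse bidisc f_d G"
  shows "\<exists>t::real. 0 \<le> t \<and> t \<le> 1 \<and>
           (\<forall>z\<in>bidisc. G z = of_real t * z $ 1 + (1 - of_real t) * z $ 2)"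
proof -
  obtain k where k: "\<And>z. z \<in> bidisc \<Longrightarrow> z $ 1 \<noteq> z $ 2 \<Longrightarrow> (G z - z $ 2) / (z $ 1 - z $ 2) = k"
    using Lempert_left_inverse_quotient_constant[OF assms] by blast
  have z0: "vector [1/2, 0] \<in> bidisc" "vector [1/2, 0] $ 1 \<noteq> (vector [1/2, 0] :: complex ^ 2) $ 2"
    by (simp_all add: bidisc_def)
  obtain t where t: "0 \<le> t" "t \<le> 1" "k = complex_of_real t"
    using Lempert_left_inverse_quotient_real[OF assms z0] k[OF z0] by metis
  have "G z = of_real t * z $ 1 + (1 - of_real t) * z $ 2" if z: "z \<in> bidisc" for z
  proof (cases "z $ 1 = z $ 2")
    case True
    then have "z = f_d (z $ 1)"
      by (simp add: f_d_def vec_eq_iff forall_2)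
    moreover have "G (f_d (z $ 1)) = z $ 1"
      using assms z by (auto simp: Lempert_left_inverse_def left_inverse_def bidisc_def)
    ultimately have "G z = z $ 1"
      by metis
    then show ?thesis
      using True by (simp add: algebra_simps)
  next
    case False
    then have "G z - z $ 2 = of_real t * (z $ 1 - z $ 2)"
      using k[OF z False] t(3) by (simp add: divide_eq_eq)
    then show ?thesis
      by (simp add: algebra_simps)
  qed
  then show ?thesis
    using t by blast
qed

end
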